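(* Let $n\ge 0$, let $\sigma\in I_n$, let $p\in[1,n]$ and let $k\ge 1$ be an integer. If $\Theta^k(\sigma)_p\le k$, then $\Theta^{k-1}(\sigma)_p=\Theta^k(\sigma)_p$.
   Context: For integers $a\le b$, $[a,b]=\{i\in\mathbb Z: a\le i\le b\}$. $I_n$ is the set of inversion sequences of length $n$, i.e. integer sequences $\sigma=(\sigma_1,\ldots,\sigma_n)$ with $0\le\sigma_i<i$ for every $i\in[1,n]$. For a finite integer sequence $\sigma$ of length $n$, $\Theta(\sigma)$ is the sequence of length $n$ defined by $\Theta(\sigma)_i=\#\{j<i:\sigma_j<\sigma_i\}$. $\Theta^k$ denotes the $k$-fold iterate of $\Theta$, with $\Theta^0$ the identity. *)

theory Defs
  imports Main
begin

text \<open>Finite sequences are lists, with entries numbered from 1 as in the mathematics;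
  \<open>entry \<sigma> i\<close> is only meaningful for \<open>1 \<le> i \<le> length \<sigma>\<close>.\<close>

definition entry :: "'a list \<Rightarrow> nat \<Rightarrow> 'a" where
  "entry \<sigma> i = \<sigma> ! (i - 1)"

definition inversion_seqs :: "nat \<Rightarrow> int list set" where
  "inversion_seqs n =
     {\<sigma>. length \<sigma> = n \<and> (\<forall>i\<in>{1..n}. 0 \<le> entry \<sigma> i \<and> entry \<sigma> i < int i)}"

definition Theta :: "int list \<Rightarrow> int list" where
  "Theta \<sigma> =
     map (\<lambda>i. int (card {j \<in> {1..<i}. entry \<sigma> j < entry \<sigma> i})) [1..<length \<sigma> + 1]"

lemma length_Theta [simp]: "length (Theta \<sigma>) = length \<sigma>"
  by (simp add: Theta_def del: upt_Suc)

lemma entry_Theta: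
  assumes "i \<in> {1..length \<sigma>}"
  shows "entry (Theta \<sigma>) i = int (card {j \<in> {1..<i}. entry \<sigma> j < entry \<sigma> i})"
proof -
  from assms have "1 \<le> i" "i \<le> length \<sigma>" by simp_all
  then have "[1..<length \<sigma> + 1] ! (i - 1) = i"
    using assms by (simp add: nth_upt del: upt_Suc)
  moreover have "i - 1 < length [1..<length \<sigma> + 1]"
    using assms by (simp add: less_eq_Suc_le del: upt_Suc)
  ultimately show ?thesis
    unfolding Theta_def entry_def[of "map _ _"] by (simp only: nth_map)
qed

end

theory Submission
  imports Defs
begin

text \<open>On inversion sequences \<open>\<Theta>\<close> is entrywise increasing: if \<open>\<sigma>\<^sub>p = v\<close>, then the
  first \<open>v\<close> entries are all smaller than \<open>v\<close>. Argue by induction on \<open>k\<close> and suppose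
  \<open>v = \<Theta>\<^sup>k\<^sup>-\<^sup>1(\<sigma>)\<^sub>p < \<Theta>\<^sup>k(\<sigma>)\<^sub>p \<le> k\<close>. Then \<open>v \<le> k - 1\<close>, so \<open>\<Theta>\<^sup>k\<^sup>-\<^sup>2(\<sigma>)\<^sub>p = v\<close> as well.
  Hence \<open>\<Theta>\<^sup>k\<^sup>-\<^sup>1(\<sigma>)\<^sub>p\<close> and \<open>\<Theta>\<^sup>k(\<sigma>)\<^sub>p\<close> count the earlier entries below the same threshold \<open>v\<close>,
  in \<open>\<Theta>\<^sup>k\<^sup>-\<^sup>2(\<sigma>)\<close> and in the entrywise larger \<open>\<Theta>\<^sup>k\<^sup>-\<^sup>1(\<sigma>)\<close>, which gives
  \<open>\<Theta>\<^sup>k(\<sigma>)\<^sub>p \<le> \<Theta>\<^sup>k\<^sup>-\<^sup>1(\<sigma>)\<^sub>p\<close>. For \<open>k = 1\<close> the threshold is \<open>v = 0\<close>, below which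
  there is no entry.\<close>

lemma Theta_inversion_seqs:
  assumes "\<sigma> \<in> inversion_seqs n"
  shows "Theta \<sigma> \<in> inversion_seqs n"
proof -
  have len: "length \<sigma> = n"
    using assms by (simp add: inversion_seqs_def)
  have "entry (Theta \<sigma>) i < int i" if "i \<in> {1..n}" for i
  proof -
    have "card {j \<in> {1..<i}. entry \<sigma> j < entry \<sigma> i} \<le> card {1..<i}"
      by (rule card_mono) auto
    also have "\<dots> < i"
      using that by simp
    finally show ?thesis
      using that by (simp add: entry_Theta len)
  qed
  then show ?thesis
    by (simp add: inversion_seqs_def len entry_Theta)
qed

lemma funpow_Theta_inversion_seqs:
  "\<sigma> \<in> inversion_seqs n \<Longrightarrow> (Theta ^^ k) \<sigma> \<in> inversion_seqs n"
  by (induction k) (simp_all add: Theta_inversion_seqs)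

lemma entry_le_entry_Theta:
  assumes "\<sigma> \<in> inversion_seqs n" "p \<in> {1..n}"
  shows "entry \<sigma> p \<le> entry (Theta \<sigma>) p"
proof -
  have len: "length \<sigma> = n" and bounds: "\<And>i. i \<in> {1..n} \<Longrightarrow> 0 \<le> entry \<sigma> i \<and> entry \<sigma> i < int i"
    using assms(1) by (simp_all add: inversion_seqs_def)
  define v where "v = nat (entry \<sigma> p)"
  have v: "entry \<sigma> p = int v" and "v < p"
    using bounds[OF assms(2)] by (auto simp: v_def)
  \<comment> \<open>For \<open>j \<le> v\<close>, position \<open>j\<close> holds at most
    \<open>j - 1\<close>, which is below \<open>v\<close>; and \<open>v < p\<close> puts it before
    \<open>p\<close>.\<close>
  have "{1..v} \<subseteq> {j \<in> {1..<p}. entry \<sigma> j < entry \<sigma> p}"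
  proof
    fix j assume "j \<in> {1..v}"
    then show "j \<in> {j \<in> {1..<p}. entry \<sigma> j < entry \<sigma> p}"
      using bounds[of j] \<open>v < p\<close> assms(2) v by auto
  qed
  then have "card {1..v} \<le> card {j \<in> {1..<p}. entry \<sigma> j < entry \<sigma> p}"
    by (intro card_mono) auto
  then show ?thesis
    using assms(2) by (simp add: entry_Theta len v)
qed

text \<open>Raising earlier entries under a fixed threshold can only remove positions from the
  counted set.\<close>

lemma entry_Theta_antimono:
  assumes "\<sigma> \<in> inversion_seqs n" "\<tau> \<in> inversion_seqs n" "p \<in> {1..n}"
    and le: "\<And>j. j \<in> {1..<p} \<Longrightarrow> entry \<sigma> j \<le> entry \<tau> j"
    and eq: "entry \<sigma> p = entry \<tau> p"
  shows "entry (Theta \<tau>) p \<le> entry (Theta \<sigma>) p"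
proof -
  have "length \<sigma> = n" "length \<tau> = n"
    using assms(1,2) by (simp_all add: inversion_seqs_def)
  moreover have "card {j \<in> {1..<p}. entry \<tau> j < entry \<tau> p}
      \<le> card {j \<in> {1..<p}. entry \<sigma> j < entry \<sigma> p}"
    using le by (intro card_mono) (auto simp: eq intro: le_less_trans)
  ultimately show ?thesis
    using assms(3) by (simp add: entry_Theta)
qed

lemma entry_funpow_Theta_stable:
  assumes "\<sigma> \<in> inversion_seqs n" "p \<in> {1..n}"
    and "entry ((Theta ^^ Suc k) \<sigma>) p \<le> int (Suc k)"
  shows "entry ((Theta ^^ k) \<sigma>) p = entry ((Theta ^^ Suc k) \<sigma>) p"
  using assms(3)
proof (induction k)
  case 0
  have len: "length \<sigma> = n" and nonneg: "\<And>j. j \<in> {1..n} \<Longrightarrow> 0 \<le> entry \<sigma> j"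
    using assms(1) by (simp_all add: inversion_seqs_def)
  have le: "entry \<sigma> p \<le> entry (Theta \<sigma>) p"
    using assms(1,2) by (rule entry_le_entry_Theta)
  show ?case
  proof (rule ccontr)
    assume "\<not> ?case"
    \<comment> \<open>The case hypothesis \<open>0\<close> caps the larger entry at 1, so strictness
      leaves only 0.\<close>
    with 0 le nonneg[OF assms(2)] have "entry \<sigma> p = 0"
      by simp
    then have "{j \<in> {1..<p}. entry \<sigma> j < entry \<sigma> p} = {}"
      using nonneg assms(2) by (force simp: not_less)
    then have "entry (Theta \<sigma>) p = 0"
      using assms(2) by (simp add: entry_Theta len)
    with \<open>entry \<sigma> p = 0\<close> \<open>\<not> ?case\<close> show False
      by simp
  qed
next
  case (Suc k)
  define \<tau> where "\<tau> = (Theta ^^ k) \<sigma>"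
  have \<tau>: "\<tau> \<in> inversion_seqs n"
    unfolding \<tau>_def using assms(1) by (rule funpow_Theta_inversion_seqs)
  then have \<tau>': "Theta \<tau> \<in> inversion_seqs n"
    by (rule Theta_inversion_seqs)
  have IH: "entry (Theta \<tau>) p \<le> int (Suc k) \<Longrightarrow> entry \<tau> p = entry (Theta \<tau>) p"
    using Suc.IH by (simp add: \<tau>_def)
  have bound: "entry (Theta (Theta \<tau>)) p \<le> int (Suc (Suc k))"
    using Suc.prems by (simp add: \<tau>_def)
  have le: "entry (Theta \<tau>) p \<le> entry (Theta (Theta \<tau>)) p"
    using \<tau>' assms(2) by (rule entry_le_entry_Theta)
  have "entry (Theta \<tau>) p = entry (Theta (Theta \<tau>)) p"
  proof (rule ccontr)
    assume neq: "entry (Theta \<tau>) p \<noteq> entry (Theta (Theta \<tau>)) p"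
    \<comment> \<open>Integrality turns the strict inequality into the bound \<open>Suc k\<close>
      that \<open>IH\<close> requires.\<close>
    with le bound have "entry \<tau> p = entry (Theta \<tau>) p"
      by (intro IH) simp
    moreover have "entry \<tau> j \<le> entry (Theta \<tau>) j" if "j \<in> {1..<p}" for j
      using \<tau> that assms(2) by (intro entry_le_entry_Theta) auto
    ultimately have "entry (Theta (Theta \<tau>)) p \<le> entry (Theta \<tau>) p"
      using entry_Theta_antimono[OF \<tau> \<tau>' assms(2)] by blast
    with le neq show False
      by simp
  qed
  then show ?case
    by (simp add: \<tau>_def)
qed

theorem proposition3p4:
  fixes n p k :: nat and \<sigma> :: "int list"
  assumes "\<sigma> \<in> inversion_seqs n"
    and "p \<in> {1..n}"
    and "k \<ge> 1"
    and "entry ((Theta ^^ k) \<sigma>) p \<le> int k"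
  shows "entry ((Theta ^^ (k - 1)) \<sigma>) p = entry ((Theta ^^ k) \<sigma>) p"
  using entry_funpow_Theta_stable[of \<sigma> n p "k - 1"] assms by simp

end
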